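(* For every large free wedge there exists a finite deterministic automaton that explores it using three pebbles.
   Context: The oriented grid $\mathbb{Z}\times\mathbb{Z}$ is embedded in the plane (nodes at integer points, edges between nodes at distance 1); nodes are anonymous and every node has ports $N,E,S,W$ pointing North, East, South, West. Given two half-lines $H_1,H_2$ in the plane with a common origin $O$ (arbitrary real directions), let $W(H_1,H_2)$ be the closed region swept clockwise from $H_1$ to $H_2$ (half-lines included); the wedge is the subgraph of the grid induced by the grid nodes in $W(H_1,H_2)$. It is large if the clockwise angle $\alpha$ from $H_1$ to $H_2$ satisfies $\pi\le\alpha\le2\pi$. A wedge is free if both boundaries are free, i.e., all ports at all nodes are free and the agent moves in the whole grid unrestricted, but must visit all nodes of the wedge; for free wedges the origin $O$ is the starting node of the agent. The agent is a finite deterministic (Mealy) automaton carrying $p$ pebbles: at each step it sees whether a pebble lies on the current node and how many pebbles it carries; depending on its state and this input it moves through a port, possibly dropping a pebble on the empty current node (if it carries one) or picking up the pebble lying there, and changes state. It starts in its initial state with all $p$ pebbles, with no pebbles on the grid. The automaton explores the wedge if every node of the wedge is eventually visited. *)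

theory Defs
  imports Complex_Main
begin

type_synonym node = "int \<times> int"

datatype port = North | East | South | West

text \<open>The plane is identified with the complex plane: East is the direction of \<open>1\<close>,
  North the direction of \<open>\<i>\<close>. Every port is free at every node, so moving is total.\<close>

fun neighbour :: "node \<Rightarrow> port \<Rightarrow> node" where
  "neighbour (x, y) North = (x, y + 1)"
| "neighbour (x, y) East = (x + 1, y)"
| "neighbour (x, y) South = (x, y - 1)"
| "neighbour (x, y) West = (x - 1, y)"

definition point :: "node \<Rightarrow> complex" where
  "point v = Complex (of_int (fst v)) (of_int (snd v))"

definition half_line :: "complex \<Rightarrow> complex set \<Rightarrow> bool" where
  "half_line c H \<longleftrightarrow> (\<exists>d. d \<noteq> 0 \<and> H = {c + of_real t * d |t. 0 \<le> t})"

definition rotate_cw :: "complex \<Rightarrow> real \<Rightarrow> complex \<Rightarrow> complex" where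
  "rotate_cw c \<phi> z = c + cis (- \<phi>) * (z - c)"

text \<open>The angle is a relation because for \<open>H\<^sub>1 = H\<^sub>2\<close> both \<open>0\<close> (the wedge is the half-line)
  and \<open>2 * pi\<close> (the wedge is the whole plane) are admissible; for distinct half-lines it is
  unique.\<close>

definition clockwise_angle :: "complex \<Rightarrow> complex set \<Rightarrow> complex set \<Rightarrow> real \<Rightarrow> bool" where
  "clockwise_angle c H\<^sub>1 H\<^sub>2 \<alpha> \<longleftrightarrow>
     0 \<le> \<alpha> \<and> \<alpha> \<le> 2 * pi \<and> H\<^sub>2 = rotate_cw c \<alpha> ` H\<^sub>1"

definition swept_region :: "complex \<Rightarrow> complex set \<Rightarrow> real \<Rightarrow> complex set" where
  "swept_region c H\<^sub>1 \<alpha> = (\<Union>\<phi>\<in>{0..\<alpha>}. rotate_cw c \<phi> ` H\<^sub>1)"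

definition wedge_nodes :: "complex \<Rightarrow> complex set \<Rightarrow> real \<Rightarrow> node set" where
  "wedge_nodes c H\<^sub>1 \<alpha> = {v. point v \<in> swept_region c H\<^sub>1 \<alpha>}"

datatype pebble_action = Keep | Drop | Pick

text \<open>The input of the automaton consists of a Boolean (is there a pebble on the current node?)
  and the number of pebbles carried.\<close>

record 'q automaton =
  states :: "'q set"
  init :: 'q
  trans :: "'q \<Rightarrow> bool \<Rightarrow> nat \<Rightarrow> 'q"
  act :: "'q \<Rightarrow> bool \<Rightarrow> nat \<Rightarrow> pebble_action"
  exit_port :: "'q \<Rightarrow> bool \<Rightarrow> nat \<Rightarrow> port"

definition legal_action :: "pebble_action \<Rightarrow> bool \<Rightarrow> nat \<Rightarrow> bool" where
  "legal_action a b k \<longleftrightarrow> (a = Drop \<longrightarrow> \<not> b \<and> 0 < k) \<and> (a = Pick \<longrightarrow> b)"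

definition finite_pebble_automaton :: "nat \<Rightarrow> 'q automaton \<Rightarrow> bool" where
  "finite_pebble_automaton p A \<longleftrightarrow>
     finite (states A) \<and> init A \<in> states A \<and>
     (\<forall>q\<in>states A. \<forall>b. \<forall>k\<le>p.
        trans A q b k \<in> states A \<and> legal_action (act A q b k) b k)"

record 'q config =
  state :: 'q
  pos :: node
  pebbles :: "node set"
  carried :: nat

definition initial_config :: "nat \<Rightarrow> 'q automaton \<Rightarrow> node \<Rightarrow> 'q config" where
  "initial_config p A v = \<lparr>state = init A, pos = v, pebbles = {}, carried = p\<rparr>"

text \<open>The pebble action takes place at the current node, before the move.\<close>

definition step :: "'q automaton \<Rightarrow> 'q config \<Rightarrow> 'q config" where
  "step A c =
     (let q = state c; v = pos c; k = carried c; b = (v \<in> pebbles c); a = act A q b k in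
      \<lparr>state = trans A q b k,
       pos = neighbour v (exit_port A q b k),
       pebbles = (case a of Keep \<Rightarrow> pebbles c
                          | Drop \<Rightarrow> insert v (pebbles c)
                          | Pick \<Rightarrow> pebbles c - {v}),
       carried = (case a of Keep \<Rightarrow> k | Drop \<Rightarrow> k - 1 | Pick \<Rightarrow> k + 1)\<rparr>)"

definition explores :: "nat \<Rightarrow> 'q automaton \<Rightarrow> node \<Rightarrow> node set \<Rightarrow> bool" where
  "explores p A v S \<longleftrightarrow>
     (\<forall>u\<in>S. \<exists>n. pos ((step A ^^ n) (initial_config p A v)) = u)"

end

theory Submission
  imports Defs
begin

text \<open>A single automaton visits the whole grid with three pebbles, so the shape of the wedge is
  irrelevant. Relative to the starting node, the \<open>n\<close>-th tour has its pebbles at the corners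
  \<open>(0, n)\<close>, \<open>(-2 n, -n)\<close> and \<open>(2 n, -n)\<close> of a triangle whose slanted sides have slopes \<open>1\<close> and
  \<open>-1\<close> and whose base is horizontal. The agent walks along the sides, a pebble telling it where
  each side ends, and carries every pebble by a constant offset to the corresponding corner of the
  next triangle. The choice of offsets makes each walk end exactly on the next pebble. Since
  \<open>(x, y)\<close> lies on the boundary of the triangle with \<open>n = max (\<bar>x\<bar> + y) (-y)\<close>, the boundaries
  exhaust the grid.\<close>

text \<open>Legality is demanded for every input, reachable or not. The guard secures it in states
  where the tour always finds an empty node and has a pebble to drop.\<close>

definition drop_if_possible :: "bool \<Rightarrow> nat \<Rightarrow> pebble_action" where
  "drop_if_possible b k = (if \<not> b \<and> 0 < k then Drop else Keep)"

text \<open>States 0 and 11 climb the right side, 1 places the top pebble, 2 and 3 descend the left side,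
  4 to 6 place the left pebble, 7 follows the base, 8 to 10 place the right pebble. The tests
  \<open>k = 3\<close> and \<open>k = 2\<close> succeed only at the origin during the degenerate tour \<open>n = 0\<close>, where the
  third pebble is dropped at the origin to play the role of the right corner.\<close>

definition tour_rule :: "nat \<Rightarrow> bool \<Rightarrow> nat \<Rightarrow> nat \<times> pebble_action \<times> port" where
  "tour_rule q b k =
     [if b then (1, Pick, North) else if k = 3 then (1, Keep, North) else (11, Keep, West),
      (2, drop_if_possible b k, South),
      if b then (4, Pick, West) else if k = 2 then (4, Drop, West) else (3, Keep, West),
      (2, Keep, South),
      (5, Keep, West),
      (6, Keep, South),
      (7, drop_if_possible b k, North),
      if b then (8, Pick, East) else (7, Keep, East),
      (9, Keep, East),
      (10, Keep, South),
      (11, drop_if_possible b k, West),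
      (0, Keep, North)] ! q"

definition tour_automaton :: "nat automaton" where
  "tour_automaton =
     \<lparr>states = {..<12}, init = 0,
      trans = \<lambda>q b k. fst (tour_rule q b k),
      act = \<lambda>q b k. fst (snd (tour_rule q b k)),
      exit_port = \<lambda>q b k. snd (snd (tour_rule q b k))\<rparr>"

lemma finite_tour_automaton: "finite_pebble_automaton p tour_automaton"
proof -
  have "fst (tour_rule q b k) < 12 \<and> legal_action (fst (snd (tour_rule q b k))) b k"
    if "q < 12" for q b k
  proof -
    have "q \<in> {0, 1, 2, 3, 4, 5, 6, 7, 8, 9, 10, 11}"
      using that by (simp, presburger)
    then show ?thesis
      by (auto simp: tour_rule_def legal_action_def drop_if_possible_def)
  qed
  then show ?thesis
    by (simp add: finite_pebble_automaton_def tour_automaton_def)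
qed

abbreviation cfg :: "nat \<Rightarrow> node \<Rightarrow> node set \<Rightarrow> nat \<Rightarrow> nat config" where
  "cfg q u P k \<equiv> \<lparr>state = q, pos = u, pebbles = P, carried = k\<rparr>"

definition reaches :: "nat config \<Rightarrow> nat config \<Rightarrow> bool" where
  "reaches c d \<longleftrightarrow> (\<exists>n. (step tour_automaton ^^ n) c = d)"

lemma reaches_refl [simp]: "reaches c c"
  unfolding reaches_def by (rule exI [of _ 0]) simp

lemma reaches_trans [trans]: "reaches c d \<Longrightarrow> reaches d e \<Longrightarrow> reaches c e"
  unfolding reaches_def by (metis comp_apply funpow_add)

lemma reaches_step: "reaches (step tour_automaton c) d \<Longrightarrow> reaches c d"
  unfolding reaches_def by (metis comp_apply funpow_Suc_right)

lemmas tour_step_simps =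
  step_def tour_automaton_def tour_rule_def drop_if_possible_def Let_def

text \<open>Two moves make one diagonal step. State 3 ignores its input, so only the diagonal nodes
  must be free of pebbles.\<close>

lemma reaches_down_left:
  assumes "\<And>i. i < m \<Longrightarrow> (x - int i, y - int i) \<notin> P"
  shows "reaches (cfg 2 (x, y) P 0) (cfg 2 (x - int m, y - int m) P 0)"
  using assms
proof (induction m)
  case (Suc m)
  have "reaches (cfg 2 (x, y) P 0) (cfg 2 (x - int m, y - int m) P 0)"
    using Suc by simp
  also have "reaches \<dots> (cfg 2 (x - int (Suc m), y - int (Suc m)) P 0)"
    by (rule reaches_step, rule reaches_step)
       (use Suc.prems [of m] in \<open>simp add: tour_step_simps algebra_simps\<close>)
  finally show ?case .
qed simp

lemma reaches_right:
  assumes "\<And>i. i < m \<Longrightarrow> (x + int i, y) \<notin> P"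
  shows "reaches (cfg 7 (x, y) P k) (cfg 7 (x + int m, y) P k)"
  using assms
proof (induction m)
  case (Suc m)
  have "reaches (cfg 7 (x, y) P k) (cfg 7 (x + int m, y) P k)"
    using Suc by simp
  also have "reaches \<dots> (cfg 7 (x + int (Suc m), y) P k)"
    by (rule reaches_step)
       (use Suc.prems [of m] in \<open>simp add: tour_step_simps algebra_simps\<close>)
  finally show ?case .
qed simp

lemma reaches_up_left:
  assumes "\<And>i. i < m \<Longrightarrow> (x - int i, y + int i) \<notin> P"
  shows "reaches (cfg 0 (x, y) P 0) (cfg 0 (x - int m, y + int m) P 0)"
  using assms
proof (induction m)
  case (Suc m)
  have "reaches (cfg 0 (x, y) P 0) (cfg 0 (x - int m, y + int m) P 0)"
    using Suc by simp
  also have "reaches \<dots> (cfg 0 (x - int (Suc m), y + int (Suc m)) P 0)"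
    by (rule reaches_step, rule reaches_step)
       (use Suc.prems [of m] in \<open>simp add: tour_step_simps algebra_simps\<close>)
  finally show ?case .
qed simp

context
  fixes a b :: int
begin

abbreviation top_corner :: "nat \<Rightarrow> node" where
  "top_corner n \<equiv> (a, b + int n)"

abbreviation left_corner :: "nat \<Rightarrow> node" where
  "left_corner n \<equiv> (a - 2 * int n, b - int n)"

abbreviation right_corner :: "nat \<Rightarrow> node" where
  "right_corner n \<equiv> (a + 2 * int n, b - int n)"

definition at_top :: "nat \<Rightarrow> nat config" where
  "at_top n = cfg 0 (top_corner n) {top_corner n, left_corner n, right_corner n} 0"

text \<open>The degenerate tour joins the regular cycle here, so the induction over tours runs
  through this configuration; in \<open>at_top 0\<close> the three corners would coincide.\<close>

definition past_left :: "nat \<Rightarrow> nat config" where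
  "past_left n = cfg 4 (a - 2 * int n - 1, b - int n) {top_corner (Suc n), right_corner n} 1"

lemma initial_reaches_past_left:
  "reaches (initial_config 3 tour_automaton (a, b)) (past_left 0)"
  unfolding initial_config_def past_left_def
  by (rule reaches_step, rule reaches_step, rule reaches_step)
     (simp add: tour_step_simps insert_commute)

lemma at_top_reaches_left_side:
  assumes "0 < n" and "m \<le> 2 * n"
  shows "reaches (at_top n)
    (cfg 2 (a - int m, b + int n - int m)
       {top_corner (Suc n), left_corner n, right_corner n} 0)"
proof -
  have "reaches (at_top n)
      (cfg 2 (a, b + int n) {top_corner (Suc n), left_corner n, right_corner n} 0)"
    unfolding at_top_def
    by (rule reaches_step, rule reaches_step)
       (use assms in \<open>simp add: tour_step_simps insert_Diff_if algebra_simps\<close>)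
  also have "reaches \<dots> (cfg 2 (a - int m, b + int n - int m)
      {top_corner (Suc n), left_corner n, right_corner n} 0)"
    \<comment> \<open>The top pebble has moved up, the right one is off this diagonal as
      \<open>0 < n\<close>, and the left one is met only after \<open>2 * n\<close> steps.\<close>
    by (rule reaches_down_left) (use assms in auto)
  finally show ?thesis .
qed

lemma at_top_reaches_past_left:
  assumes "0 < n"
  shows "reaches (at_top n) (past_left n)"
proof -
  have "reaches (at_top n) (cfg 2 (left_corner n)
      {top_corner (Suc n), left_corner n, right_corner n} 0)"
    using at_top_reaches_left_side [OF assms, of "2 * n"] by simp
  also have "reaches \<dots> (past_left n)"
    unfolding past_left_def
    by (rule reaches_step) (use assms in \<open>simp add: tour_step_simps insert_Diff_if\<close>)
  finally show ?thesis .
qed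

lemma past_left_reaches_base:
  assumes "m \<le> 4 * n + 2"
  shows "reaches (past_left n)
    (cfg 7 (a - 2 * int n - 2 + int m, b - int n)
       {top_corner (Suc n), left_corner (Suc n), right_corner n} 0)"
proof -
  have "reaches (past_left n) (cfg 7 (a - 2 * int n - 2, b - int n)
      {top_corner (Suc n), left_corner (Suc n), right_corner n} 0)"
    unfolding past_left_def
    by (rule reaches_step, rule reaches_step, rule reaches_step)
       (simp add: tour_step_simps insert_commute algebra_simps)
  also have "reaches \<dots> (cfg 7 (a - 2 * int n - 2 + int m, b - int n)
      {top_corner (Suc n), left_corner (Suc n), right_corner n} 0)"
    \<comment> \<open>For positive \<open>n\<close> the walk crosses \<open>left_corner n\<close>,
      whose pebble is already gone; the first pebble met is the one at
      \<open>right_corner n\<close>.\<close>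
    by (rule reaches_right) (use assms in auto)
  finally show ?thesis .
qed

text \<open>Here \<open>m\<close> counts from \<open>right_corner (Suc n)\<close>. That corner is
  left in state 10, and state 0 first occurs one diagonal step further, hence
  \<open>0 < m\<close>.\<close>

lemma past_left_reaches_right_side:
  assumes "0 < m" and "m \<le> 2 * n + 2"
  shows "reaches (past_left n)
    (cfg 0 (a + 2 * int n + 2 - int m, b - int n - 1 + int m)
       {top_corner (Suc n), left_corner (Suc n), right_corner (Suc n)} 0)"
proof -
  let ?P = "{top_corner (Suc n), left_corner (Suc n), right_corner (Suc n)}"
  have "reaches (past_left n) (cfg 7 (right_corner n)
      {top_corner (Suc n), left_corner (Suc n), right_corner n} 0)"
    using past_left_reaches_base [of "4 * n + 2" n] by simp
  also have "reaches \<dots> (cfg 0 (a + 2 * int n + 1, b - int n) ?P 0)"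
    by (rule reaches_step, rule reaches_step, rule reaches_step, rule reaches_step,
        rule reaches_step)
       (simp add: tour_step_simps insert_Diff_if insert_commute algebra_simps)
  also have "reaches \<dots> (cfg 0 (a + 2 * int n + 1 - int (m - 1), b - int n + int (m - 1)) ?P 0)"
    by (rule reaches_up_left) (use assms in auto)
  finally show ?thesis
    using assms by (simp add: of_nat_diff algebra_simps)
qed

lemma past_left_reaches_at_top: "reaches (past_left n) (at_top (Suc n))"
  using past_left_reaches_right_side [of "2 * n + 2" n] by (simp add: at_top_def algebra_simps)

lemma initial_reaches_tour:
  "reaches (initial_config 3 tour_automaton (a, b)) (past_left n)"
proof (induction n)
  case 0
  show ?case by (rule initial_reaches_past_left)
next
  case (Suc n)
  also note past_left_reaches_at_top
  also have "reaches (at_top (Suc n)) (past_left (Suc n))"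
    by (rule at_top_reaches_past_left) simp
  finally show ?case .
qed

lemma tour_visits:
  "\<exists>c. reaches (initial_config 3 tour_automaton (a, b)) c \<and> pos c = (a + x, b + y)"
proof -
  let ?init = "initial_config 3 tour_automaton (a, b)"
  have visited: ?thesis if "reaches ?init c" and "pos c = (a + x, b + y)" for c
    using that by blast
  define n where "n = nat (max (\<bar>x\<bar> + y) (- y))"
  have n: "int n = max (\<bar>x\<bar> + y) (- y)"
    unfolding n_def by linarith
  \<comment> \<open>The base with its end points, and the slanted sides without them; the second
    case forces \<open>n\<close> to be positive.\<close>
  consider "int n = - y" "\<bar>x\<bar> \<le> 2 * int n"
    | "int n = \<bar>x\<bar> + y" "- y < int n"
    using n by linarith
  then show ?thesis
  proof cases
    case 1
    define m where "m = nat (x + 2 * int n + 2)"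
    have m: "int m = x + 2 * int n + 2" "m \<le> 4 * n + 2"
      using 1 by (auto simp: m_def)
    note initial_reaches_tour [of n]
    also note past_left_reaches_base [OF m(2)]
    finally show ?thesis
      by (rule visited) (use 1 m in simp)
  next
    case 2
    then obtain k where k: "n = Suc k"
      by (cases n) auto
    show ?thesis
    proof (cases "x \<le> 0")
      case True
      define m where "m = nat (- x)"
      have m: "int m = - x" "m \<le> 2 * n"
        using 2 True by (auto simp: m_def)
      note initial_reaches_tour [of k]
      also note past_left_reaches_at_top
      also have "reaches (at_top (Suc k)) (cfg 2 (a - int m, b + int n - int m)
          {top_corner (Suc n), left_corner n, right_corner n} 0)"
        using at_top_reaches_left_side [of n m] m k by simp
      finally show ?thesis
        by (rule visited) (use 2 True m in simp)
    next
      case False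
      define m where "m = nat (2 * int n - x)"
      have m: "int m = 2 * int n - x" "0 < m" "m \<le> 2 * k + 2"
        using 2 False k by (auto simp: m_def)
      \<comment> \<open>The right side of triangle \<open>Suc k\<close> is climbed at the end of
        tour \<open>k\<close>, on the way to \<open>at_top (Suc k)\<close>.\<close>
      note initial_reaches_tour [of k]
      also note past_left_reaches_right_side [OF m(2,3)]
      finally show ?thesis
        by (rule visited) (use 2 False m k in simp)
    qed
  qed
qed

end

lemma tour_automaton_explores: "explores 3 tour_automaton v S"
proof -
  have "\<exists>n. pos ((step tour_automaton ^^ n) (initial_config 3 tour_automaton v)) = u" for u
    using tour_visits [of "fst v" "snd v" "fst u - fst v" "snd u - snd v"]
    by (auto simp: reaches_def)
  then show ?thesis
    by (simp add: explores_def)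
qed

theorem theorem10:
  fixes v :: node and H\<^sub>1 H\<^sub>2 :: "complex set" and \<alpha> :: real
  assumes "half_line (point v) H\<^sub>1"
    and "half_line (point v) H\<^sub>2"
    and "clockwise_angle (point v) H\<^sub>1 H\<^sub>2 \<alpha>"
    and "pi \<le> \<alpha>" and "\<alpha> \<le> 2 * pi"
  shows "\<exists>A :: nat automaton.
    finite_pebble_automaton 3 A \<and> explores 3 A v (wedge_nodes (point v) H\<^sub>1 \<alpha>)"
  using finite_tour_automaton tour_automaton_explores by blast

end
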